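(* Let $\mathcal{H}$ and $\mathcal{K}$ be complex Hilbert spaces, let $T\in\mathcal{B}(\mathcal{H})$ have closed range, let $B\in\mathcal{B}(\mathcal{K},\mathcal{H})$ be injective with closed range, let $C\in\mathcal{B}(\mathcal{H},\mathcal{K})$ be surjective, and suppose $T=BC$. Then the following are equivalent: (1) $T$ is EP. (2) There exists an isomorphism $V\in\mathcal{B}(\mathcal{K})$ such that $C=VB^*$. (3) There exists $N\in\mathcal{B}(\mathcal{K})$ injective with closed range such that $C=NB^*$. (4) There exist $S_1,S_2\in\mathcal{B}(\mathcal{K})$ such that $C=S_1B^*$ and $B^*=S_2C$.
   Context: $\mathcal{B}(\mathcal{H},\mathcal{K})$ denotes the bounded linear operators from $\mathcal{H}$ to $\mathcal{K}$, and $\mathcal{B}(\mathcal{H})=\mathcal{B}(\mathcal{H},\mathcal{H})$. $\mathcal{N}(T)$ is the kernel of $T$ and $T^*$ its adjoint. An operator $T\in\mathcal{B}(\mathcal{H})$ with closed range is called EP if $\mathcal{N}(T)=\mathcal{N}(T^* )$. A bounded operator is an isomorphism if it is injective and onto (not necessarily isometric). *)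

theory Defs
  imports "HOL-Analysis.Analysis"
begin

text \<open>
  The library has real inner product spaces only. Complex ones are built on top of the real normed
  spaces of the library, so that norm, topology and completeness are the library notions; the inner
  product is linear in its first argument.
\<close>

class complex_inner = real_normed_vector +
  fixes scaleC :: "complex \<Rightarrow> 'a \<Rightarrow> 'a"  (infixr "*\<^sub>C" 75)
    and cinner :: "'a \<Rightarrow> 'a \<Rightarrow> complex"
  assumes scaleC_add_right: "a *\<^sub>C (x + y) = a *\<^sub>C x + a *\<^sub>C y"
    and scaleC_add_left: "(a + b) *\<^sub>C x = a *\<^sub>C x + b *\<^sub>C x"
    and scaleC_scaleC: "a *\<^sub>C b *\<^sub>C x = (a * b) *\<^sub>C x"
    and scaleC_of_real: "complex_of_real r *\<^sub>C x = r *\<^sub>R x"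
    and cinner_commute: "cinner x y = cnj (cinner y x)"
    and cinner_add_left: "cinner (x + y) z = cinner x z + cinner y z"
    and cinner_scaleC_left: "cinner (a *\<^sub>C x) y = a * cinner x y"
    and cinner_self: "cinner x x = complex_of_real ((norm x)\<^sup>2)"

class complex_hilbert_space = complex_inner + complete_space

instantiation complex :: complex_hilbert_space
begin

definition "scaleC a x = a * (x :: complex)"
definition "cinner x y = x * cnj (y :: complex)"

instance
proof
  show "cinner x x = complex_of_real ((norm x)\<^sup>2)" for x :: complex
    unfolding cinner_complex_def by (rule complex_norm_square [symmetric])
qed (simp_all add: scaleC_complex_def cinner_complex_def algebra_simps scaleR_conv_of_real)

end

locale bounded_clinear = bounded_linear f
  for f :: "'a::complex_inner \<Rightarrow> 'b::complex_inner" +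
  assumes scaleC: "f (a *\<^sub>C x) = a *\<^sub>C f x"

text \<open>
  By the Riesz representation theorem the adjoint below exists (and is then unique) whenever
  \<open>f\<close> is a bounded operator between Hilbert spaces; it is not meaningful otherwise.
\<close>

definition cadjoint ::
    "('a::complex_hilbert_space \<Rightarrow> 'b::complex_hilbert_space) \<Rightarrow> 'b \<Rightarrow> 'a" where
  "cadjoint f = (THE g. bounded_clinear g \<and> (\<forall>x y. cinner (f x) y = cinner x (g y)))"

definition kernel :: "('a \<Rightarrow> 'b::zero) \<Rightarrow> 'a set" where
  "kernel f = {x. f x = 0}"

definition EP_operator :: "('a::complex_hilbert_space \<Rightarrow> 'a) \<Rightarrow> bool" where
  "EP_operator T \<longleftrightarrow>
     bounded_clinear T \<and> closed (range T) \<and> kernel T = kernel (cadjoint T)"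

definition isomorphism_operator ::
    "('a::complex_hilbert_space \<Rightarrow> 'b::complex_hilbert_space) \<Rightarrow> bool" where
  "isomorphism_operator V \<longleftrightarrow> bounded_clinear V \<and> inj V \<and> surj V"

end

theory Submission
  imports Defs
begin

text \<open>
  Since \<open>B\<close> is injective, \<open>T = B \<circ> C\<close> has the kernel of \<open>C\<close>; since \<open>C\<close> is surjective, a vector is
  orthogonal to \<open>range T\<close> exactly when it is orthogonal to \<open>range B\<close>, so \<open>T\<^sup>*\<close> has the kernel of
  \<open>B\<^sup>*\<close>. Hence \<open>T\<close> is EP iff \<open>C\<close> and \<open>B\<^sup>*\<close> have the same kernel. Each of the three
  factorization conditions forces this: composing with an injective operator on the left does not
  change the kernel, and a factorization in each direction gives the two inclusions.

  Conversely, an injective operator \<open>B\<close> with closed range is bounded below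
  (\<open>injective_closed_range_bounded_below\<close>), so \<open>B\<^sup>* \<circ> B\<close> is invertible and \<open>B\<^sup>*\<close> has the bounded
  right inverse \<open>D = B \<circ> (B\<^sup>* \<circ> B)\<^sup>-\<^sup>1\<close> (\<open>cadjoint_right_inverse\<close>). If the kernels of \<open>C\<close> and
  \<open>B\<^sup>*\<close> agree, then \<open>C\<close> kills \<open>x - D (B\<^sup>* x)\<close>, so \<open>V = C \<circ> D\<close> satisfies \<open>C = V \<circ> B\<^sup>*\<close>; it is
  injective because of the equality of the kernels, and surjective because \<open>C\<close> is. Applying the
  lower bound to \<open>V\<close> itself makes \<open>V\<^sup>-\<^sup>1\<close> bounded, which gives the second factor in (4).

  The Hilbert space facts behind this are the projection theorem, the Riesz representation theorem
  (for the existence of adjoints) and the Baire category theorem (for the lower bound).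
\<close>

section \<open>Complex inner products\<close>

lemma cinner_add_right:
  fixes x y z :: "'a::complex_inner"
  shows "cinner x (y + z) = cinner x y + cinner x z"
  by (metis cinner_add_left cinner_commute complex_cnj_add)

lemma cinner_scaleC_right:
  fixes x y :: "'a::complex_inner"
  shows "cinner x (a *\<^sub>C y) = cnj a * cinner x y"
  by (metis cinner_commute cinner_scaleC_left complex_cnj_mult)

lemma scaleC_minus1:
  fixes x :: "'a::complex_inner"
  shows "(-1) *\<^sub>C x = - x"
  using scaleC_of_real[of "-1" x] by simp

lemma cinner_minus_left:
  fixes x y :: "'a::complex_inner"
  shows "cinner (- x) y = - cinner x y"
  using cinner_scaleC_left[of "-1" x y] by (simp add: scaleC_minus1)

lemma cinner_minus_right:
  fixes x y :: "'a::complex_inner"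
  shows "cinner x (- y) = - cinner x y"
  using cinner_scaleC_right[of x "-1" y] by (simp add: scaleC_minus1)

lemma cinner_diff_left:
  fixes x y z :: "'a::complex_inner"
  shows "cinner (x - y) z = cinner x z - cinner y z"
  using cinner_add_left[of x "- y" z] by (simp add: cinner_minus_left)

lemma cinner_diff_right:
  fixes x y z :: "'a::complex_inner"
  shows "cinner x (y - z) = cinner x y - cinner x z"
  using cinner_add_right[of x y "- z"] by (simp add: cinner_minus_right)

lemma cinner_zero_left [simp]: "cinner 0 (y::'a::complex_inner) = 0"
  using cinner_diff_left[of y y y] by simp

lemma cinner_zero_right [simp]: "cinner (x::'a::complex_inner) 0 = 0"
  using cinner_diff_right[of x x x] by simp

lemma cinner_self_eq_0_iff: "cinner x x = 0 \<longleftrightarrow> (x::'a::complex_inner) = 0"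
  by (simp add: cinner_self)

lemma Re_cinner_commute: "Re (cinner x y) = Re (cinner y (x::'a::complex_inner))"
  by (metis cinner_commute cnj.simps(1))

lemma norm_add_squared:
  fixes x y :: "'a::complex_inner"
  shows "(norm (x + y))\<^sup>2 = (norm x)\<^sup>2 + (norm y)\<^sup>2 + 2 * Re (cinner x y)"
proof -
  have "complex_of_real ((norm (x + y))\<^sup>2)
      = cinner x x + cinner y y + (cinner x y + cinner y x)"
    unfolding cinner_self[symmetric] by (simp add: cinner_add_left cinner_add_right)
  then have "Re (complex_of_real ((norm (x + y))\<^sup>2))
      = Re (cinner x x + cinner y y + (cinner x y + cinner y x))"
    by (rule arg_cong)
  then show ?thesis
    using Re_cinner_commute[of x y] by (simp only: cinner_self plus_complex.simps Re_complex_of_real)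
qed

lemma norm_diff_squared:
  fixes x y :: "'a::complex_inner"
  shows "(norm (x - y))\<^sup>2 = (norm x)\<^sup>2 + (norm y)\<^sup>2 - 2 * Re (cinner x y)"
  using norm_add_squared[of x "- y"] by (simp add: cinner_minus_right)

lemma parallelogram_law:
  fixes x y :: "'a::complex_inner"
  shows "(norm (x - y))\<^sup>2 = 2 * (norm x)\<^sup>2 + 2 * (norm y)\<^sup>2 - (norm (x + y))\<^sup>2"
  by (simp add: norm_add_squared norm_diff_squared)

lemma norm_scaleC:
  fixes x :: "'a::complex_inner"
  shows "norm (a *\<^sub>C x) = cmod a * norm x"
proof -
  have "complex_of_real ((norm (a *\<^sub>C x))\<^sup>2) = (a * cnj a) * cinner x x"
    unfolding cinner_self[symmetric] by (simp add: cinner_scaleC_left cinner_scaleC_right)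
  also have "\<dots> = complex_of_real ((cmod a * norm x)\<^sup>2)"
    by (simp add: cinner_self complex_norm_square[symmetric] power_mult_distrib)
  finally have "(norm (a *\<^sub>C x))\<^sup>2 = (cmod a * norm x)\<^sup>2"
    by (simp only: of_real_eq_iff)
  then show ?thesis by (simp add: power2_eq_iff_nonneg)
qed

text \<open>
  The squared length of the residue of \<open>x\<close> after subtracting its component along \<open>y\<close>; both the
  Cauchy-Schwarz inequality and the orthogonality of the closest point are read off from it.
\<close>

lemma norm_residue_squared:
  fixes x y :: "'a::complex_inner"
  assumes "y \<noteq> 0"
  shows "(norm (x - (cinner x y / complex_of_real ((norm y)\<^sup>2)) *\<^sub>C y))\<^sup>2
         = (norm x)\<^sup>2 - (cmod (cinner x y))\<^sup>2 / (norm y)\<^sup>2"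
proof -
  let ?N = "(norm y)\<^sup>2" and ?a = "cinner x y"
  let ?c = "?a / complex_of_real ?N"
  have N: "?N \<noteq> 0" using assms by simp
  have "cinner x (?c *\<^sub>C y) = complex_of_real ((cmod ?a)\<^sup>2 / ?N)"
    by (simp only: cinner_scaleC_right)
       (simp add: mult.commute complex_norm_square[symmetric])
  then have "Re (cinner x (?c *\<^sub>C y)) = (cmod ?a)\<^sup>2 / ?N"
    by (simp only: Re_complex_of_real)
  moreover have "(norm (?c *\<^sub>C y))\<^sup>2 = (cmod ?a)\<^sup>2 / ?N"
    using N by (simp add: norm_scaleC norm_divide norm_mult norm_power power_mult_distrib power_divide
        power2_eq_square)
  ultimately show ?thesis by (simp add: norm_diff_squared)
qed

lemma cinner_Cauchy_Schwarz:
  fixes x y :: "'a::complex_inner"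
  shows "cmod (cinner x y) \<le> norm x * norm y"
proof (cases "y = 0")
  case False
  then have "0 \<le> (norm x)\<^sup>2 - (cmod (cinner x y))\<^sup>2 / (norm y)\<^sup>2"
    using norm_residue_squared[OF False, of x] by (metis zero_le_power2)
  then have "(cmod (cinner x y))\<^sup>2 \<le> (norm x * norm y)\<^sup>2"
    using False by (simp add: field_simps power_mult_distrib)
  then show ?thesis by (rule power2_le_imp_le) simp
qed simp

section \<open>Bounded complex-linear maps\<close>

lemma bounded_clinearI:
  assumes "\<And>x y. f (x + y) = f x + f y" "\<And>a x. f (a *\<^sub>C x) = a *\<^sub>C f x"
    and "\<And>x. norm (f x) \<le> norm x * K"
  shows "bounded_clinear f"
proof -
  have "bounded_linear f"
    by (rule bounded_linear_intro[where K = K]) (metis assms scaleC_of_real)+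
  then show ?thesis
    using assms(2) by (simp add: bounded_clinear_def bounded_clinear_axioms_def)
qed

lemma bounded_clinear_compose:
  assumes "bounded_clinear f" "bounded_clinear g"
  shows "bounded_clinear (f \<circ> g)"
proof -
  interpret f: bounded_clinear f by fact
  interpret g: bounded_clinear g by fact
  have "bounded_linear (f \<circ> g)"
    unfolding o_def
    by (rule bounded_linear_compose[OF f.bounded_linear_axioms g.bounded_linear_axioms])
  then show ?thesis
    by (simp add: bounded_clinear_def bounded_clinear_axioms_def f.scaleC g.scaleC)
qed

lemma bounded_clinear_cinner_left: "bounded_clinear (\<lambda>x. cinner x y)"
  by (rule bounded_clinearI[where K = "norm y"])
     (simp_all add: cinner_add_left cinner_scaleC_left scaleC_complex_def cinner_Cauchy_Schwarz)

lemma bounded_linear_cinner_left: "bounded_linear (\<lambda>x. cinner x y)"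
  using bounded_clinear_cinner_left bounded_clinear.axioms(1) by blast

lemma bounded_linear_cinner_right: "bounded_linear (\<lambda>y. cinner x y)"
proof (rule bounded_linear_intro[where K = "norm x"])
  show "cinner x (r *\<^sub>R y) = r *\<^sub>R cinner x y" for r y
    using cinner_scaleC_right[of x "complex_of_real r" y]
    by (simp add: scaleC_of_real scaleR_conv_of_real)
qed (simp_all add: cinner_add_right cinner_Cauchy_Schwarz mult.commute[of _ "norm x"])

lemma bounded_linear_scaleC: "bounded_linear (\<lambda>x::'a::complex_inner. a *\<^sub>C x)"
  by (rule bounded_linear_intro[where K = "cmod a"])
     (simp_all add: scaleC_add_right scaleC_of_real[symmetric] scaleC_scaleC norm_scaleC mult.commute)

lemma kernel_comp_inj:
  assumes "bounded_clinear f" "inj f"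
  shows "kernel (f \<circ> g) = kernel g"
proof -
  interpret bounded_clinear f by fact
  have "f z = 0 \<longleftrightarrow> z = 0" for z
    using assms(2) zero by (metis injD)
  then show ?thesis by (simp add: kernel_def)
qed

text \<open>A bounded operator onto the whole space that is bounded below has a bounded inverse.\<close>

lemma bounded_clinear_inv:
  assumes "bounded_clinear f" "surj f" "c > 0" "\<And>x. c * norm x \<le> norm (f x)"
  shows "inj f" "bounded_clinear (inv f)"
proof -
  interpret bounded_clinear f by fact
  show inj: "inj f"
  proof (rule injI)
    fix x y assume "f x = f y"
    then have "c * norm (x - y) \<le> 0"
      using assms(4)[of "x - y"] by (simp add: diff)
    then show "x = y" using assms(3) by (simp add: mult_le_0_iff)
  qed
  have f_inv: "f (inv f y) = y" for y
    using assms(2) by (simp add: surj_f_inv_f)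
  show "bounded_clinear (inv f)"
  proof (rule bounded_clinearI[where K = "inverse c"])
    show "inv f (x + y) = inv f x + inv f y" for x y
      by (rule injD[OF inj]) (simp add: f_inv add)
    show "inv f (a *\<^sub>C x) = a *\<^sub>C inv f x" for a x
      by (rule injD[OF inj]) (simp add: f_inv scaleC)
    show "norm (inv f x) \<le> norm x * inverse c" for x
      using assms(4)[of "inv f x"] assms(3) by (simp add: f_inv field_simps)
  qed
qed

section \<open>Orthogonal projection and Riesz representation\<close>

text \<open>Complex subspaces: real subspaces that are closed under complex scalars.\<close>

definition csubspace :: "'a::complex_inner set \<Rightarrow> bool" where
  "csubspace M \<longleftrightarrow> subspace M \<and> (\<forall>a. \<forall>x\<in>M. a *\<^sub>C x \<in> M)"

lemma csubspace_range:
  assumes "bounded_clinear f"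
  shows "csubspace (range f)"
proof -
  interpret bounded_clinear f by fact
  have "subspace (range f)"
    by (rule linear_subspace_image[OF linear_axioms subspace_UNIV])
  then show ?thesis
    by (auto simp: csubspace_def scaleC[symmetric])
qed

lemma csubspace_kernel:
  assumes "bounded_clinear f"
  shows "csubspace (kernel f)"
proof -
  interpret bounded_clinear f by fact
  have "a *\<^sub>C (0::'b) = 0" for a
    using norm_scaleC[of a "0::'b"] by simp
  then show ?thesis
    by (auto simp: csubspace_def kernel_def subspace_def add scaleC scaleR)
qed

lemma csubspace_closure:
  assumes "csubspace M"
  shows "csubspace (closure M)"
proof -
  have sub: "subspace M" and scale: "\<And>a x. x \<in> M \<Longrightarrow> a *\<^sub>C x \<in> M"
    using assms by (auto simp: csubspace_def)
  have closure_scale: "a *\<^sub>C x \<in> closure M" if "x \<in> closure M" for a x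
  proof -
    have "(\<lambda>x. a *\<^sub>C x) ` closure M \<subseteq> closure ((\<lambda>x. a *\<^sub>C x) ` M)"
      by (rule closure_bounded_linear_image_subset[OF bounded_linear_scaleC])
    also have "\<dots> \<subseteq> closure M"
      using scale by (intro closure_mono) auto
    finally show ?thesis using that by blast
  qed
  have "subspace (closure M)"
    unfolding subspace_def
  proof (intro conjI ballI allI)
    show "0 \<in> closure M"
      using subspace_0[OF sub] closure_subset by blast
    show "r *\<^sub>R x \<in> closure M" if "x \<in> closure M" for r x
      using closure_scale[OF that, of "complex_of_real r"] by (simp add: scaleC_of_real)
    fix x y assume "x \<in> closure M" "y \<in> closure M"
    then obtain X Y where XY: "\<And>n. X n \<in> M" "X \<longlonglongrightarrow> x" "\<And>n. Y n \<in> M" "Y \<longlonglongrightarrow> y"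
      by (auto simp: closure_sequential)
    then have "\<And>n. X n + Y n \<in> M" "(\<lambda>n. X n + Y n) \<longlonglongrightarrow> x + y"
      using sub by (auto intro: subspace_add tendsto_add)
    then show "x + y \<in> closure M"
      unfolding closure_sequential by (intro exI[of _ "\<lambda>n. X n + Y n"]) simp
  qed
  then show ?thesis
    using closure_scale by (simp add: csubspace_def)
qed

lemma closest_point_exists:
  fixes M :: "'a::complex_hilbert_space set"
  assumes M: "csubspace M" "closed M"
  shows "\<exists>p\<in>M. \<forall>m\<in>M. norm (x - p) \<le> norm (x - m)"
proof -
  have sub: "subspace M" and ne: "M \<noteq> {}"
    using M(1) by (auto simp: csubspace_def subspace_def)
  define D where "D = (INF m\<in>M. (norm (x - m))\<^sup>2)"
  have bdd: "bdd_below ((\<lambda>m. (norm (x - m))\<^sup>2) ` M)"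
    by (rule bdd_belowI[where m = 0]) auto
  have D_le: "D \<le> (norm (x - m))\<^sup>2" if "m \<in> M" for m
    unfolding D_def by (rule cINF_lower[OF bdd that])
  have "\<exists>m\<in>M. (norm (x - m))\<^sup>2 < D + 1 / real (Suc n)" for n
    using cINF_less_iff[OF ne bdd, of "D + 1 / real (Suc n)"] by (simp add: D_def)
  then obtain s where sM: "\<And>n. s n \<in> M"
    and s: "\<And>n. (norm (x - s n))\<^sup>2 < D + 1 / real (Suc n)"
    by metis
  have dist_s: "(norm (s i - s j))\<^sup>2 \<le> 2 / real (Suc i) + 2 / real (Suc j)" for i j
  proof -
    \<comment> \<open>The midpoint of \<open>s i\<close> and \<open>s j\<close> is in \<open>M\<close>, hence no closer to \<open>x\<close> than \<open>D\<close> allows.\<close>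
    have "(1/2) *\<^sub>R (s i + s j) \<in> M"
      using sub sM by (simp add: subspace_add subspace_scale)
    then have "D \<le> (norm (x - (1/2) *\<^sub>R (s i + s j)))\<^sup>2" by (rule D_le)
    moreover have "(x - s j) + (x - s i) = 2 *\<^sub>R (x - (1/2) *\<^sub>R (s i + s j))"
      by (simp add: algebra_simps scaleR_2)
    then have "(norm ((x - s j) + (x - s i)))\<^sup>2 = 4 * (norm (x - (1/2) *\<^sub>R (s i + s j)))\<^sup>2"
      by (simp only: norm_scaleR power_mult_distrib) simp
    ultimately show ?thesis
      using parallelogram_law[of "x - s j" "x - s i"] s[of i] s[of j] by simp
  qed
  have "Cauchy s"
  proof (rule CauchyI)
    fix e :: real assume "e > 0"
    then obtain N where N: "1 / real (Suc N) < e\<^sup>2 / 4"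
      using nat_approx_posE[of "e\<^sup>2 / 4"] by auto
    show "\<exists>N. \<forall>m\<ge>N. \<forall>n\<ge>N. norm (s m - s n) < e"
    proof (intro exI allI impI)
      fix m n assume mn: "N \<le> m" "N \<le> n"
      have "1 / real (Suc m) \<le> 1 / real (Suc N)" "1 / real (Suc n) \<le> 1 / real (Suc N)"
        using mn by (simp_all add: frac_le)
      then have "(norm (s m - s n))\<^sup>2 < e\<^sup>2"
        using dist_s[of m n] N by linarith
      then show "norm (s m - s n) < e"
        by (rule power_less_imp_less_base) (use \<open>e > 0\<close> in simp)
    qed
  qed
  then obtain p where p: "s \<longlonglongrightarrow> p"
    using Cauchy_convergent_iff convergent_def by blast
  have "p \<in> M"
    using closed_sequentially[OF M(2)] sM p by blast
  moreover have "(norm (x - p))\<^sup>2 \<le> D"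
  proof (rule LIMSEQ_le)
    show "(\<lambda>n. (norm (x - s n))\<^sup>2) \<longlonglongrightarrow> (norm (x - p))\<^sup>2"
      by (intro tendsto_intros p)
    show "(\<lambda>n. D + 1 / real (Suc n)) \<longlonglongrightarrow> D"
      using tendsto_add[OF tendsto_const LIMSEQ_inverse_real_of_nat, of D]
      by (simp add: inverse_eq_divide)
    show "\<exists>N. \<forall>n\<ge>N. (norm (x - s n))\<^sup>2 \<le> D + 1 / real (Suc n)"
      using s less_imp_le by blast
  qed
  ultimately show ?thesis
    using D_le by (meson norm_ge_zero order_trans power2_le_imp_le)
qed

lemma orthogonal_projection_exists:
  fixes M :: "'a::complex_hilbert_space set"
  assumes M: "csubspace M" "closed M"
  shows "\<exists>p\<in>M. \<forall>m\<in>M. cinner (x - p) m = 0"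
proof -
  obtain p where p: "p \<in> M" and min: "\<And>m. m \<in> M \<Longrightarrow> norm (x - p) \<le> norm (x - m)"
    using closest_point_exists[OF M] by blast
  have "cinner (x - p) m = 0" if m: "m \<in> M" for m
  proof (cases "m = 0")
    case False
    define c where "c = cinner (x - p) m / complex_of_real ((norm m)\<^sup>2)"
    have "p + c *\<^sub>C m \<in> M"
      using M(1) m p by (simp add: csubspace_def subspace_add)
    from min[OF this] have "norm (x - p) \<le> norm ((x - p) - c *\<^sub>C m)"
      by (simp add: diff_diff_eq)
    then have "(norm (x - p))\<^sup>2 \<le> (norm ((x - p) - c *\<^sub>C m))\<^sup>2"
      by (simp add: power_mono)
    then have "(cmod (cinner (x - p) m))\<^sup>2 / (norm m)\<^sup>2 \<le> 0"
      unfolding c_def norm_residue_squared[OF False] by simp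
    then show ?thesis
      using False by (simp add: divide_le_0_iff)
  qed simp
  then show ?thesis using p by blast
qed

lemma closed_csubspace_eq_UNIV:
  fixes M :: "'a::complex_hilbert_space set"
  assumes "csubspace M" "closed M" and "\<And>z. (\<And>m. m \<in> M \<Longrightarrow> cinner z m = 0) \<Longrightarrow> z = 0"
  shows "M = UNIV"
proof -
  have "x \<in> M" for x
  proof -
    obtain p where "p \<in> M" "\<forall>m\<in>M. cinner (x - p) m = 0"
      using orthogonal_projection_exists[OF assms(1,2)] by blast
    then show ?thesis using assms(3)[of "x - p"] by simp
  qed
  then show ?thesis by blast
qed

lemma Riesz_representation:
  fixes f :: "'a::complex_hilbert_space \<Rightarrow> complex"
  assumes "bounded_clinear f"
  shows "\<exists>v. \<forall>x. f x = cinner x v"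
proof (cases "\<forall>x. f x = 0")
  case True
  then show ?thesis by (intro exI[of _ 0]) simp
next
  case False
  interpret bounded_clinear f by fact
  obtain x0 where x0: "f x0 \<noteq> 0" using False by blast
  have "closed (kernel f)"
    unfolding kernel_def
    by (intro closed_Collect_eq continuous_on_const linear_continuous_on bounded_linear_axioms)
  then obtain p where p: "p \<in> kernel f" "\<And>m. m \<in> kernel f \<Longrightarrow> cinner (x0 - p) m = 0"
    using orthogonal_projection_exists[OF csubspace_kernel[OF assms]] by blast
  define q where "q = x0 - p"
  have fq: "f q \<noteq> 0" using x0 p(1) by (simp add: q_def diff kernel_def)
  then have q0: "q \<noteq> 0" using zero by blast
  \<comment> \<open>\<open>q\<close> spans the orthogonal complement of the kernel, so it represents \<open>f\<close> up to a scalar.\<close>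
  define v where "v = (cnj (f q) / complex_of_real ((norm q)\<^sup>2)) *\<^sub>C q"
  have "f x = cinner x v" for x
  proof -
    have "x - (f x / f q) *\<^sub>C q \<in> kernel f"
      using fq by (simp add: kernel_def diff scaleC scaleC_complex_def)
    then have "cinner (x - (f x / f q) *\<^sub>C q) q = 0"
      using p(2) cinner_commute[of _ q] by (simp add: q_def)
    then have "cinner x q = (f x / f q) * complex_of_real ((norm q)\<^sup>2)"
      by (simp only: cinner_diff_left cinner_scaleC_left cinner_self) simp
    then show ?thesis
      using fq q0 by (simp add: v_def cinner_scaleC_right)
  qed
  then show ?thesis by blast
qed

section \<open>Adjoints\<close>

lemma cinner_right_ext:
  fixes u v :: "'a::complex_inner"
  assumes "\<And>x. cinner x u = cinner x v"
  shows "u = v"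
proof -
  have "cinner (u - v) (u - v) = 0"
    by (simp add: cinner_diff_right assms)
  then show ?thesis by (simp add: cinner_self_eq_0_iff)
qed

lemma adjoint_exists:
  fixes f :: "'a::complex_hilbert_space \<Rightarrow> 'b::complex_hilbert_space"
  assumes "bounded_clinear f"
  shows "\<exists>g. bounded_clinear g \<and> (\<forall>x y. cinner (f x) y = cinner x (g y))"
proof -
  interpret bounded_clinear f by fact
  have "\<exists>v. \<forall>x. cinner (f x) y = cinner x v" for y
    using Riesz_representation[OF bounded_clinear_compose[OF bounded_clinear_cinner_left assms]]
    by (simp add: o_def)
  then obtain g where g: "\<And>x y. cinner (f x) y = cinner x (g y)"
    by metis
  obtain K where K0: "K > 0" and K: "\<And>x. norm (f x) \<le> norm x * K"
    using pos_bounded by blast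
  have "bounded_clinear g"
  proof (rule bounded_clinearI[where K = K])
    show "g (y + z) = g y + g z" for y z
      by (rule cinner_right_ext) (simp add: g[symmetric] cinner_add_right)
    show "g (a *\<^sub>C y) = a *\<^sub>C g y" for a y
      by (rule cinner_right_ext) (simp add: g[symmetric] cinner_scaleC_right)
    show "norm (g y) \<le> norm y * K" for y
    proof (cases "g y = 0")
      case True
      then show ?thesis using K0 by simp
    next
      case False
      have "norm (g y) * norm (g y) = cmod (cinner (f (g y)) y)"
        by (simp add: g cinner_self norm_power power2_eq_square norm_mult)
      also have "\<dots> \<le> norm (f (g y)) * norm y" by (rule cinner_Cauchy_Schwarz)
      also have "\<dots> \<le> (norm (g y) * K) * norm y" by (intro mult_right_mono K) simp
      finally have "norm (g y) * norm (g y) \<le> norm (g y) * (norm y * K)"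
        by (simp add: mult_ac)
      then show ?thesis using False by simp
    qed
  qed
  then show ?thesis using g by blast
qed

lemma
  fixes f :: "'a::complex_hilbert_space \<Rightarrow> 'b::complex_hilbert_space"
  assumes "bounded_clinear f"
  shows bounded_clinear_cadjoint: "bounded_clinear (cadjoint f)"
    and cinner_cadjoint: "cinner (f x) y = cinner x (cadjoint f y)"
proof -
  let ?P = "\<lambda>g. bounded_clinear g \<and> (\<forall>x y. cinner (f x) y = cinner x (g y))"
  have "\<exists>!g. ?P g"
  proof (rule ex_ex1I[OF adjoint_exists[OF assms]])
    fix g h assume gh: "?P g" "?P h"
    show "g = h"
    proof
      show "g y = h y" for y
        by (rule cinner_right_ext) (metis gh)
    qed
  qed
  then have "?P (cadjoint f)"
    unfolding cadjoint_def by (rule theI')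
  then show "bounded_clinear (cadjoint f)" "cinner (f x) y = cinner x (cadjoint f y)"
    by blast+
qed

lemma kernel_cadjoint:
  assumes "bounded_clinear f"
  shows "kernel (cadjoint f) = {y. \<forall>x. cinner (f x) y = 0}"
proof -
  have "cadjoint f y = 0 \<longleftrightarrow> (\<forall>x. cinner x (cadjoint f y) = 0)" for y
    by (metis cinner_self_eq_0_iff cinner_zero_right)
  then show ?thesis
    by (simp add: kernel_def cinner_cadjoint[OF assms])
qed

lemma kernel_cadjoint_comp_surj:
  assumes "bounded_clinear f" "bounded_clinear g" "surj g"
  shows "kernel (cadjoint (f \<circ> g)) = kernel (cadjoint f)"
proof -
  have "(\<forall>x. cinner (f (g x)) y = 0) \<longleftrightarrow> (\<forall>z. cinner (f z) y = 0)" for y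
  proof
    assume *: "\<forall>x. cinner (f (g x)) y = 0"
    show "\<forall>z. cinner (f z) y = 0"
    proof
      show "cinner (f z) y = 0" for z
        using *[rule_format, of "inv g z"] assms(3) by (simp add: surj_f_inv_f)
    qed
  qed simp
  then show ?thesis
    by (simp add: kernel_cadjoint bounded_clinear_compose assms(1,2))
qed

lemma cadjoint_range_dense:
  assumes "bounded_clinear f" "inj f"
  shows "closure (range (cadjoint f)) = UNIV"
proof (rule closed_csubspace_eq_UNIV)
  show "csubspace (closure (range (cadjoint f)))"
    by (intro csubspace_closure csubspace_range bounded_clinear_cadjoint assms(1))
  interpret bounded_clinear f by fact
  fix x assume x: "\<And>m. m \<in> closure (range (cadjoint f)) \<Longrightarrow> cinner x m = 0"
  have "cinner (f x) (f x) = 0"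
    unfolding cinner_cadjoint[OF assms(1)] by (intro x subsetD[OF closure_subset] rangeI)
  then have "f x = f 0" by (simp add: cinner_self_eq_0_iff zero)
  then show "x = 0" by (rule injD[OF assms(2)])
qed simp

section \<open>Lower bounds for injective operators with closed range\<close>

text \<open>
  The image of a ball under an injective operator is cut out of the range by closed conditions.
  This is where the weak compactness of balls in a Hilbert space enters, in the guise of the
  density of the range of the adjoint.
\<close>

lemma norm_le_iff_cadjoint:
  assumes f: "bounded_clinear f" "inj f" and "0 \<le> r"
  shows "norm x \<le> r \<longleftrightarrow> (\<forall>z. cmod (cinner (f x) z) \<le> r * norm (cadjoint f z))" (is "_ \<longleftrightarrow> ?R")
proof
  assume "norm x \<le> r"
  then show ?R
    unfolding cinner_cadjoint[OF f(1)]
    by (meson cinner_Cauchy_Schwarz mult_right_mono norm_ge_zero order_trans)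
next
  assume R: ?R
  let ?W = "{w. cmod (cinner x w) \<le> r * norm w}"
  have "closed ?W"
    by (intro closed_Collect_le continuous_intros linear_continuous_on bounded_linear_cinner_right)
  moreover have "range (cadjoint f) \<subseteq> ?W"
    using R by (auto simp: cinner_cadjoint[OF f(1)])
  ultimately have W: "w \<in> ?W" for w
    using closure_minimal cadjoint_range_dense[OF f] by blast
  show "norm x \<le> r"
  proof (cases "x = 0")
    case True
    then show ?thesis using \<open>0 \<le> r\<close> by simp
  next
    case False
    have "norm x * norm x \<le> r * norm x"
      using W[of x] by (simp add: cinner_self norm_power power2_eq_square norm_mult)
    then show ?thesis using False by simp
  qed
qed

lemma injective_closed_range_bounded_below:
  fixes f :: "'a::complex_hilbert_space \<Rightarrow> 'b::complex_hilbert_space"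
  assumes f: "bounded_clinear f" "inj f" "closed (range f)"
  shows "\<exists>c>0. \<forall>x. c * norm x \<le> norm (f x)"
proof -
  interpret bounded_clinear f by fact
  \<comment> \<open>These sets cover the range, which is complete, so Baire's theorem applies to them.\<close>
  define F where "F n = f ` cball 0 (real n)" for n :: nat
  let ?X = "top_of_set (range f)"
  have F_eq: "F n = range f \<inter> (\<Inter>z. {y. cmod (cinner y z) \<le> real n * norm (cadjoint f z)})" for n
    using norm_le_iff_cadjoint[OF f(1,2), where r = "real n"] by (auto simp: F_def)
  have F_closed: "closedin ?X (F n)" for n
    unfolding F_eq
    by (intro closedin_closed_Int closed_INT ballI closed_Collect_le continuous_intros
        linear_continuous_on bounded_linear_cinner_left)
  have "\<Union>(range F) = range f"
  proof -
    have "f x \<in> \<Union>(range F)" for x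
    proof -
      obtain n where "norm x \<le> real n"
        using real_arch_simple by blast
      then have "f x \<in> F n" by (simp add: F_def)
      then show ?thesis by blast
    qed
    then show ?thesis by (auto simp: F_def)
  qed
  then have ne: "?X interior_of \<Union>(range F) \<noteq> {}"
    using interior_of_topspace[of ?X] by simp
  have complete: "completely_metrizable_space ?X"
    using completely_metrizable_space_closedin[OF completely_metrizable_space_euclidean] f(3)
    by simp
  \<comment> \<open>Some image of a ball has interior; translating to the origin gives the bound in \<open>small\<close>.\<close>
  have "\<exists>n. ?X interior_of F n \<noteq> {}"
  proof (rule ccontr)
    assume "\<not> ?thesis"
    then have "?X interior_of \<Union>(range F) = {}"
      by (intro Baire_category_alt disjI1 complete) (use F_closed in auto)
    with ne show False by contradiction
  qed
  then obtain n where "?X interior_of F n \<noteq> {}" by blast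
  then obtain U y0 where U: "openin ?X U" "U \<subseteq> F n" "y0 \<in> U"
    unfolding interior_of_def by blast
  then obtain x0 where x0: "y0 = f x0" "norm x0 \<le> real n"
    by (auto simp: F_def)
  obtain e where e: "e > 0" "ball y0 e \<inter> range f \<subseteq> U"
    using U(1,3) unfolding openin_contains_ball by blast
  have small: "norm x \<le> 2 * real n" if "norm (f x) < e" for x
  proof -
    have "f (x0 + x) \<in> ball y0 e"
      using that by (simp add: x0 add dist_norm)
    then have "f (x0 + x) \<in> F n" using e U(2) by blast
    then have "norm (x0 + x) \<le> real n"
      using f(2) by (auto simp: F_def inj_image_mem_iff)
    then show ?thesis
      using norm_triangle_ineq4[of "x0 + x" x0] x0(2) by simp
  qed
  \<comment> \<open>The summand 1 only keeps the denominator positive when \<open>n = 0\<close>.\<close>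
  have "e / (4 * real n + 1) * norm x \<le> norm (f x)" for x
  proof (cases "f x = 0")
    case True
    then have "f x = f 0" by (simp add: zero)
    then have "x = 0" by (rule injD[OF f(2)])
    then show ?thesis by simp
  next
    case False
    \<comment> \<open>Rescale \<open>x\<close> so that its image has norm \<open>e / 2\<close>.\<close>
    define t where "t = e / (2 * norm (f x))"
    have "t > 0" using False e(1) by (simp add: t_def)
    have "norm (f (t *\<^sub>R x)) < e"
      using False e(1) by (simp add: scaleR t_def)
    then have "t * norm x \<le> 2 * real n"
      using small[of "t *\<^sub>R x"] \<open>t > 0\<close> by simp
    then have "e * norm x \<le> 4 * real n * norm (f x)"
      using False by (simp add: t_def field_simps)
    also have "\<dots> \<le> (4 * real n + 1) * norm (f x)"
      by (simp add: algebra_simps)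
    finally show ?thesis by (simp add: field_simps)
  qed
  then show ?thesis using e(1) by (intro exI[of _ "e / (4 * real n + 1)"]) auto
qed

text \<open>
  For \<open>f\<close> bounded below, the self-adjoint operator \<open>R = f\<^sup>* \<circ> f\<close> is coercive, hence bounded below
  with dense and closed range, hence invertible; \<open>f \<circ> R\<^sup>-\<^sup>1\<close> is the right inverse.
\<close>

lemma cadjoint_right_inverse:
  fixes f :: "'a::complex_hilbert_space \<Rightarrow> 'b::complex_hilbert_space"
  assumes f: "bounded_clinear f" "inj f" "closed (range f)"
  shows "\<exists>D. bounded_clinear D \<and> (\<forall>y. cadjoint f (D y) = y)"
proof -
  obtain c where c: "c > 0" "\<And>x. c * norm x \<le> norm (f x)"
    using injective_closed_range_bounded_below[OF f] by blast
  define R where "R = cadjoint f \<circ> f"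
  have R: "bounded_clinear R"
    unfolding R_def by (intro bounded_clinear_compose bounded_clinear_cadjoint f(1))
  have R_form: "cinner x (R x) = complex_of_real ((norm (f x))\<^sup>2)" for x
    by (simp add: R_def cinner_cadjoint[OF f(1), symmetric] cinner_self)
  have below: "c\<^sup>2 * norm x \<le> norm (R x)" for x
  proof (cases "x = 0")
    case False
    have "(c * norm x)\<^sup>2 \<le> (norm (f x))\<^sup>2"
      using c by (intro power_mono) auto
    also have "\<dots> = cmod (cinner x (R x))" by (simp add: R_form norm_power)
    also have "\<dots> \<le> norm x * norm (R x)" by (rule cinner_Cauchy_Schwarz)
    finally have "norm x * (c\<^sup>2 * norm x) \<le> norm x * norm (R x)"
      by (simp add: power2_eq_square mult_ac)
    then show ?thesis using False by simp
  qed simp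
  have "complete (range R)"
    using c(1) below R
    by (intro complete_isometric_image[where e = "c\<^sup>2"])
       (auto simp: bounded_clinear_def complete_UNIV)
  then have "closed (range R)" by (rule complete_imp_closed)
  then have "range R = UNIV"
  proof (rule closed_csubspace_eq_UNIV[OF csubspace_range[OF R]])
    fix z assume "\<And>m. m \<in> range R \<Longrightarrow> cinner z m = 0"
    then have "f z = 0" using R_form[of z] by simp
    then show "z = 0" using c(1) c(2)[of z] by (simp add: mult_le_0_iff)
  qed
  then have "bounded_clinear (inv R)" "\<And>y. R (inv R y) = y"
    using bounded_clinear_inv(2)[OF R _ _ below] c(1) by (auto simp: surj_f_inv_f)
  then show ?thesis
    by (intro exI[of _ "f \<circ> inv R"]) (simp add: bounded_clinear_compose f(1), simp add: R_def)
qed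

section \<open>EP operators and their factorizations\<close>

text \<open>
  The factor is \<open>C \<circ> D\<close> for a bounded right inverse \<open>D\<close> of \<open>B\<^sup>*\<close>; no inverse of a quotient map is
  needed, so boundedness is immediate.
\<close>

lemma isomorphism_factor_of_kernel_eq:
  assumes B: "bounded_clinear B" "inj B" "closed (range B)"
    and C: "bounded_clinear C" "surj C"
    and ker: "kernel C = kernel (cadjoint B)"
  shows "\<exists>V. isomorphism_operator V \<and> C = V \<circ> cadjoint B"
proof -
  interpret C: bounded_clinear C by fact
  interpret A: bounded_clinear "cadjoint B" by (rule bounded_clinear_cadjoint[OF B(1)])
  obtain D where D: "bounded_clinear D" and BD: "\<And>y. cadjoint B (D y) = y"
    using cadjoint_right_inverse[OF B] by blast
  interpret D: bounded_clinear D by fact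
  have C_eq: "C x = C (D (cadjoint B x))" for x
  proof -
    have "x - D (cadjoint B x) \<in> kernel (cadjoint B)"
      by (simp add: kernel_def A.diff BD)
    then have "x - D (cadjoint B x) \<in> kernel C" by (simp add: ker)
    then show ?thesis by (simp add: kernel_def C.diff)
  qed
  have "inj (C \<circ> D)"
  proof (rule injI)
    fix x y assume "(C \<circ> D) x = (C \<circ> D) y"
    then have "D (x - y) \<in> kernel (cadjoint B)"
      unfolding ker[symmetric] by (simp add: kernel_def C.diff D.diff)
    then show "x = y" by (simp add: kernel_def BD)
  qed
  moreover have "surj (C \<circ> D)"
  proof (rule surjI)
    show "(C \<circ> D) (cadjoint B (inv C y)) = y" for y
      using C_eq[of "inv C y"] C(2) by (simp add: surj_f_inv_f)
  qed
  moreover have "C = (C \<circ> D) \<circ> cadjoint B"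
    using C_eq by auto
  ultimately show ?thesis
    using bounded_clinear_compose[OF C(1) D] unfolding isomorphism_operator_def by blast
qed

lemma isomorphism_operator_inv:
  assumes "isomorphism_operator V"
  shows "bounded_clinear (inv V)"
proof -
  have V: "bounded_clinear V" "inj V" "surj V"
    using assms by (auto simp: isomorphism_operator_def)
  then obtain c where "c > 0" "\<And>x. c * norm x \<le> norm (V x)"
    using injective_closed_range_bounded_below[of V] by auto
  then show ?thesis using bounded_clinear_inv(2) V by blast
qed

theorem theorem5p6:
  fixes T :: "'h::complex_hilbert_space \<Rightarrow> 'h"
    and B :: "'k::complex_hilbert_space \<Rightarrow> 'h"
    and C :: "'h \<Rightarrow> 'k"
  assumes T: "bounded_clinear T" "closed (range T)"
    and B: "bounded_clinear B" "inj B" "closed (range B)"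
    and C: "bounded_clinear C" "surj C"
    and factorization: "T = B \<circ> C"
  shows "(EP_operator T \<longleftrightarrow>
            (\<exists>V :: 'k \<Rightarrow> 'k. isomorphism_operator V \<and> C = V \<circ> cadjoint B))
       \<and> (EP_operator T \<longleftrightarrow>
            (\<exists>N :: 'k \<Rightarrow> 'k. bounded_clinear N \<and> inj N \<and> closed (range N) \<and> C = N \<circ> cadjoint B))
       \<and> (EP_operator T \<longleftrightarrow>
            (\<exists>S\<^sub>1 S\<^sub>2 :: 'k \<Rightarrow> 'k. bounded_clinear S\<^sub>1 \<and> bounded_clinear S\<^sub>2 \<and>
               C = S\<^sub>1 \<circ> cadjoint B \<and> cadjoint B = S\<^sub>2 \<circ> C))"
    (is "(?EP \<longleftrightarrow> ?V) \<and> (?EP \<longleftrightarrow> ?N) \<and> (?EP \<longleftrightarrow> ?S)")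
proof -
  have EP_iff: "?EP \<longleftrightarrow> kernel C = kernel (cadjoint B)"
    using T kernel_comp_inj[OF B(1,2), of C] kernel_cadjoint_comp_surj[OF B(1) C]
    by (simp add: EP_operator_def factorization)
  have EP_V: ?V if ?EP
    using isomorphism_factor_of_kernel_eq[OF B C] that EP_iff by blast
  have V_N: ?N if ?V
    using that unfolding isomorphism_operator_def by (metis closed_UNIV)
  have V_S: ?S if ?V
  proof -
    from that obtain V where V: "isomorphism_operator V" "C = V \<circ> cadjoint B"
      by blast
    then have "cadjoint B = inv V \<circ> C"
      by (simp add: isomorphism_operator_def o_assoc)
    then show ?thesis
      using V isomorphism_operator_inv[OF V(1)] unfolding isomorphism_operator_def by blast
  qed
  have N_EP: ?EP if ?N
  proof -
    from that obtain N :: "'k \<Rightarrow> 'k" where "bounded_clinear N" "inj N" "C = N \<circ> cadjoint B"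
      by blast
    then show ?thesis by (simp add: EP_iff kernel_comp_inj)
  qed
  have S_EP: ?EP if ?S
  proof -
    from that obtain S\<^sub>1 S\<^sub>2 :: "'k \<Rightarrow> 'k" where S: "bounded_clinear S\<^sub>1" "bounded_clinear S\<^sub>2"
      "C = S\<^sub>1 \<circ> cadjoint B" "cadjoint B = S\<^sub>2 \<circ> C"
      by blast
    have "S\<^sub>1 0 = 0" "S\<^sub>2 0 = 0"
      using S(1,2) by (simp_all add: bounded_clinear_def linear_simps)
    then show ?thesis
      unfolding EP_iff kernel_def using S(3,4) by (metis comp_apply)
  qed
  show ?thesis using EP_V V_N V_S N_EP S_EP by blast
qed

end
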